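(* Let $0 \le a < b < \infty$, let $\alpha \in [0,1]$, $m \in (0,1]$, $s \in (0,1]$, let $l \ge 1$ be a real number, and let $p, q > 0$ be fixed real numbers. Let $f : [0,\infty) \to \mathbb{R}$ be a function whose restriction to $[a,b]$ is continuous and satisfies $f \in L([a,b])$. If $|f|^l$ belongs to the class $K_{m,1}^{\alpha,s}$ on $[a,b]$, then $$\int_a^b (x-a)^p (b-x)^q f(x)\,dx \le (b-a)^{p+q+1} \left(\beta(q+1,\, p+1)\right)^{\frac{l-1}{l}} \left[ \beta(q+\alpha s+1,\, p+1)\left\{ |f(a)|^l - m\left|f\left(\tfrac{b}{m}\right)\right|^l \right\} + m\,\beta(q+1,\, p+1)\left|f\left(\tfrac{b}{m}\right)\right|^l \right]^{\frac{1}{l}}.$$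
   Context: $\beta(x,y) = \int_0^1 t^{x-1}(1-t)^{y-1}\,dt$ (for $x,y>0$) is the Euler Beta function. $L([a,b])$ denotes the Lebesgue integrable functions on $[a,b]$. A function $g : [0,\infty) \to [0,\infty)$ is said to belong to the class $K_{m,1}^{\alpha,s}$ on $[a,b]$ ($s$-$(\alpha,m)$-convex in the first sense) if for all $x, y \in [a,b]$ and all $\mu \in [0,1]$, $$g(\mu x + (1-\mu) y) \le \mu^{\alpha s}\, g(x) + m\,(1-\mu^{\alpha s})\, g\left(\frac{y}{m}\right).$$ *)

theory Defs
  imports "HOL-Analysis.Analysis"
begin

text \<open>
  Real power with the usual convention \<open>x\<^sup>0 = 1\<close> also at \<open>x = 0\<close>; in contrast, \<open>0 powr 0 = 0\<close>.
  The difference matters below only for \<open>\<alpha> = 0\<close>, \<open>\<mu> = 0\<close>.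
\<close>

definition rpow :: "real \<Rightarrow> real \<Rightarrow> real" where
  "rpow x r = (if r = 0 then 1 else x powr r)"

text \<open>
  The class \<open>K\<^bsub>m,1\<^esub>\<^bsup>\<alpha>,s\<^esup>\<close> on \<open>[a,b]\<close>. A function on \<open>[0,\<infinity>)\<close> is represented by a total function
  whose values at negative arguments are irrelevant: with \<open>0 \<le> a\<close> and \<open>0 < m\<close>, only values on
  \<open>[0,\<infinity>)\<close> are inspected.
\<close>

definition class_K1 :: "real \<Rightarrow> real \<Rightarrow> real \<Rightarrow> real \<Rightarrow> real \<Rightarrow> (real \<Rightarrow> real) set" where
  "class_K1 \<alpha> s m a b =
     {g. (\<forall>x\<ge>0. 0 \<le> g x) \<and>
         (\<forall>x\<in>{a..b}. \<forall>y\<in>{a..b}. \<forall>\<mu>\<in>{0..1}.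
            g (\<mu> * x + (1 - \<mu>) * y)
              \<le> rpow \<mu> (\<alpha> * s) * g x + m * (1 - rpow \<mu> (\<alpha> * s)) * g (y / m))}"

text \<open>
  The library defines \<^const>\<open>Beta\<close> through the Gamma function; for positive arguments it is the
  Euler integral.
\<close>

lemma Beta_eq_Euler_integral:
  fixes x y :: real
  assumes "x > 0" "y > 0"
  shows "Beta x y = integral {0..1} (\<lambda>t. t powr (x - 1) * (1 - t) powr (y - 1))"
  using has_integral_Beta_real[OF assms] by (simp add: integral_unique)

end

theory Submission
  imports Defs
begin

text \<open>
  Every \<open>x \<in> [a,b]\<close> is the convex combination \<open>\<mu> a + (1 - \<mu>) b\<close> with \<open>\<mu> = (b - x) / (b - a)\<close>,
  so membership of \<open>\<bar>f\<bar>\<^sup>l\<close> in the class bounds \<open>\<bar>f x\<bar>\<^sup>l\<close> by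
  \<open>\<mu>\<^bsup>\<alpha>s\<^esup> \<bar>f a\<bar>\<^sup>l + m (1 - \<mu>\<^bsup>\<alpha>s\<^esup>) \<bar>f (b/m)\<bar>\<^sup>l\<close>. Against the weight \<open>(x - a)\<^sup>p (b - x)\<^sup>q\<close> the powers of
  \<open>\<mu>\<close> integrate to Beta values (\<open>has_integral_Beta_weight\<close>), because they only raise the exponent
  of \<open>b - x\<close>. The weighted Hoelder inequality (\<open>weighted_Hoelder_majorant\<close>) passes from this
  bound on \<open>\<bar>f\<bar>\<^sup>l\<close> to the integral of \<open>f\<close>; the total mass of the weight supplies the factor with
  exponent \<open>(l - 1) / l\<close>.

  The Hoelder step uses Young's inequality with a free constant \<open>c\<close>, chosen at the end to
  balance its two terms. In this form the pointwise majorant of \<open>\<bar>f\<bar>\<^sup>l\<close> enters directly, and the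
  integral of \<open>\<bar>f\<bar>\<^sup>l\<close> itself never has to be formed.
\<close>

text \<open>
  This is Young's inequality for the factors \<open>u\<^sup>l c\<^bsup>1-l\<^esup>\<close> and \<open>c\<close> with weights \<open>1/l\<close> and
  \<open>1 - 1/l\<close>; equality holds at \<open>u = c\<close>. It bounds \<open>u\<close> by an affine function of its \<open>l\<close>-th power,
  which can be integrated termwise.
\<close>

lemma abs_le_affine_powr:
  fixes u c l :: real
  assumes "l \<ge> 1" "c > 0"
  shows "\<bar>u\<bar> \<le> (1 / l) * c powr (1 - l) * \<bar>u\<bar> powr l + (1 - 1 / l) * c"
proof (cases "u = 0")
  case True
  then show ?thesis using assms by simp
next
  case False
  have "(\<bar>u\<bar> powr l * c powr (1 - l)) powr (1 / l) * c powr (1 - 1 / l)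
      = \<bar>u\<bar> powr (l * (1 / l)) * c powr ((1 - l) * (1 / l) + (1 - 1 / l))"
    by (simp add: powr_mult powr_powr powr_add)
  also have "(1 - l) * (1 / l) + (1 - 1 / l) = 0"
    using assms by (simp add: field_simps)
  finally have "(\<bar>u\<bar> powr l * c powr (1 - l)) powr (1 / l) * c powr (1 - 1 / l) = \<bar>u\<bar>"
    using assms by simp
  moreover have "(\<bar>u\<bar> powr l * c powr (1 - l)) powr (1 / l) * c powr (1 - 1 / l)
      \<le> (1 / l) * (\<bar>u\<bar> powr l * c powr (1 - l)) + (1 - 1 / l) * c"
    using assms False by (intro Youngs_inequality_0) auto
  ultimately show ?thesis by (simp add: mult_ac)
qed

text \<open>
  Integrating the affine bound gives \<open>I \<le> c\<^bsup>1-l\<^esup> M / l + (1 - 1/l) c W\<close> for every \<open>c > 0\<close>.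
  The two terms balance when \<open>c\<^sup>l = M / W\<close>, and the bound becomes \<open>c W\<close>. If \<open>M = 0\<close> there is no
  such \<open>c\<close>, but then the bound tends to \<open>0\<close> with \<open>c\<close>.
\<close>

lemma weighted_Hoelder_majorant:
  fixes w u g :: "'a::euclidean_space \<Rightarrow> real"
  assumes l: "l \<ge> 1" and W: "W > 0"
    and w: "(w has_integral W) S"
    and wg: "((\<lambda>x. w x * g x) has_integral M) S"
    and wu: "((\<lambda>x. w x * u x) has_integral I) S"
    and w_nonneg: "\<And>x. x \<in> S \<Longrightarrow> 0 \<le> w x"
    and maj: "\<And>x. x \<in> S \<Longrightarrow> \<bar>u x\<bar> powr l \<le> g x"
  shows "I \<le> W powr ((l - 1) / l) * M powr (1 / l)"
proof -
  have M: "M \<ge> 0"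
  proof (rule has_integral_nonneg[OF wg])
    fix x assume "x \<in> S"
    then show "0 \<le> w x * g x"
      using w_nonneg maj powr_ge_zero order_trans by (meson mult_nonneg_nonneg)
  qed
  have bound: "I \<le> (1 / l) * c powr (1 - l) * M + (1 - 1 / l) * c * W" if c: "c > 0" for c
  proof (rule has_integral_le[OF wu])
    show "((\<lambda>x. (1 / l) * c powr (1 - l) * (w x * g x) + (1 - 1 / l) * c * w x)
        has_integral (1 / l) * c powr (1 - l) * M + (1 - 1 / l) * c * W) S"
      by (intro has_integral_add has_integral_mult_right w wg)
    fix x assume x: "x \<in> S"
    have "u x \<le> (1 / l) * c powr (1 - l) * \<bar>u x\<bar> powr l + (1 - 1 / l) * c"
      using abs_le_affine_powr[OF l c, of "u x"] by linarith
    also have "\<dots> \<le> (1 / l) * c powr (1 - l) * g x + (1 - 1 / l) * c"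
      using maj[OF x] l by (intro add_mono mult_left_mono) auto
    finally have "w x * u x \<le> w x * ((1 / l) * c powr (1 - l) * g x + (1 - 1 / l) * c)"
      by (rule mult_left_mono[OF _ w_nonneg[OF x]])
    then show "w x * u x \<le> (1 / l) * c powr (1 - l) * (w x * g x) + (1 - 1 / l) * c * w x"
      by (simp add: algebra_simps)
  qed
  show ?thesis
  proof (cases "M = 0")
    case True
    have "I \<le> 0 + e" if e: "e > 0" for e
    proof -
      have "I \<le> (1 - 1 / l) * e"
        using bound[of "e / W"] True W e by simp
      also have "\<dots> \<le> 1 * e"
        using l e by (intro mult_right_mono) auto
      finally show ?thesis by simp
    qed
    then have "I \<le> 0" by (rule field_le_epsilon)
    then show ?thesis using True by simp
  next
    case False
    with M have M: "M > 0" by simp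
    define c where "c = (M / W) powr (1 / l)"
    have c: "c > 0" using M W by (simp add: c_def)
    have cl: "c powr l = M / W"
      using M W l by (simp add: c_def powr_powr)
    have "c powr (1 - l) * M = c * W"
      using c cl M W by (simp add: powr_diff)
    then have "I \<le> (1 / l) * (c * W) + (1 - 1 / l) * c * W"
      using bound[OF c] by (simp add: mult.assoc)
    also have "\<dots> = W * c" by (simp add: algebra_simps)
    also have "\<dots> = W powr (1 - 1 / l) * M powr (1 / l)"
      using M W by (simp add: c_def powr_divide powr_diff)
    also have "1 - 1 / l = (l - 1) / l"
      using l by (simp add: field_simps)
    finally show ?thesis .
  qed
qed

text \<open>The substitution \<open>t = (x - a) / (b - a)\<close> reduces the claim to the Euler integral.\<close>

lemma has_integral_Beta_weight:
  fixes a b p q :: real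
  assumes "a < b" "p > -1" "q > -1"
  shows "((\<lambda>x. (x - a) powr p * (b - x) powr q)
           has_integral (b - a) powr (p + q + 1) * Beta (q + 1) (p + 1)) {a..b}"
proof -
  define d where "d = b - a"
  have d: "d > 0" using assms by (simp add: d_def)
  let ?h = "\<lambda>t. t powr p * (1 - t) powr q"
  have "(?h has_integral Beta (p + 1) (q + 1)) (cbox 0 1)"
    using has_integral_Beta_real[of "p + 1" "q + 1"] assms by simp
  from has_integral_affinity'[OF this, of "1 / d" "- a / d"] d
  have "((\<lambda>x. ?h ((1 / d) *\<^sub>R x + - a / d)) has_integral
        Beta (p + 1) (q + 1) /\<^sub>R (1 / d) ^ DIM(real))
      (cbox ((0 - - a / d) /\<^sub>R (1 / d)) ((1 - - a / d) /\<^sub>R (1 / d)))"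
    by simp
  also have "(1 - - a / d) /\<^sub>R (1 / d) = b"
    using d by (simp add: distrib_left) (simp add: d_def)
  also have "(0 - - a / d) /\<^sub>R (1 / d) = a"
    using d by simp
  finally have unscaled: "((\<lambda>x. (x / d - a / d) powr p * (1 - (x / d - a / d)) powr q)
          has_integral d * Beta (p + 1) (q + 1)) {a..b}"
    by simp
  have scaled: "d powr (p + q) * ((x / d - a / d) powr p * (1 - (x / d - a / d)) powr q)
      = (x - a) powr p * (b - x) powr q" if "x \<in> {a..b}" for x
  proof -
    have lower: "x / d - a / d = (x - a) / d"
      by (simp add: diff_divide_distrib)
    have "1 - (x - a) / d = d / d - (x - a) / d" using d by simp
    also have "\<dots> = (d - (x - a)) / d" by (rule diff_divide_distrib[symmetric])
    also have "d - (x - a) = b - x" by (simp add: d_def)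
    finally show ?thesis
      using that d lower by (simp add: powr_divide powr_add)
  qed
  from unscaled have "((\<lambda>x. d powr (p + q)
          * ((x / d - a / d) powr p * (1 - (x / d - a / d)) powr q))
          has_integral d powr (p + q) * (d * Beta (p + 1) (q + 1))) {a..b}"
    by (rule has_integral_mult_right)
  then have "((\<lambda>x. (x - a) powr p * (b - x) powr q)
          has_integral d powr (p + q) * (d * Beta (p + 1) (q + 1))) {a..b}"
    by (rule has_integral_eq[rotated]) (rule scaled)
  then show ?thesis
    using d by (simp add: d_def powr_add mult_ac Beta_commute)
qed

theorem theorem6:
  fixes a b \<alpha> m s l p q :: real and f :: "real \<Rightarrow> real"
  assumes "0 \<le> a" and "a < b"
    and "\<alpha> \<in> {0..1}" and "m \<in> {0<..1}" and "s \<in> {0<..1}"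
    and "l \<ge> 1" and "p > 0" and "q > 0"
    and "continuous_on {a..b} f"
    and "set_integrable lebesgue {a..b} f"
    and "(\<lambda>x. \<bar>f x\<bar> powr l) \<in> class_K1 \<alpha> s m a b"
  shows "(LINT x:{a..b}|lebesgue. (x - a) powr p * (b - x) powr q * f x)
    \<le> (b - a) powr (p + q + 1) * Beta (q + 1) (p + 1) powr ((l - 1) / l)
      * (Beta (q + \<alpha> * s + 1) (p + 1) * (\<bar>f a\<bar> powr l - m * \<bar>f (b / m)\<bar> powr l)
         + m * Beta (q + 1) (p + 1) * \<bar>f (b / m)\<bar> powr l) powr (1 / l)"
proof -
  define w where "w = (\<lambda>x. (x - a) powr p * (b - x) powr q)"
  define r where "r = \<alpha> * s"
  define \<mu> where "\<mu> = (\<lambda>x. (b - x) / (b - a))"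
  define A where "A = \<bar>f a\<bar> powr l"
  define C where "C = \<bar>f (b / m)\<bar> powr l"
  define g where "g = (\<lambda>x. rpow (\<mu> x) r * A + m * (1 - rpow (\<mu> x) r) * C)"
  define D where "D = (b - a) powr (p + q + 1)"
  define B where "B = Beta (q + 1) (p + 1)"
  define K where "K = Beta (q + r + 1) (p + 1) * (A - m * C) + m * B * C"
  have r: "r \<ge> 0" using assms by (simp add: r_def)
  have D: "D > 0" using assms by (simp add: D_def)
  have B: "B > 0" using assms by (simp add: B_def Beta_def Gamma_real_pos)

  have w_int: "(w has_integral D * B) {a..b}"
    using has_integral_Beta_weight[of a b p q] assms by (simp add: w_def D_def B_def)

  \<comment> \<open>The convention \<open>0\<^sup>0 = 1\<close> is harmless here: \<open>\<mu> x = 0\<close> only at \<open>x = b\<close>, where the weight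
    vanishes because \<open>q > 0\<close>.\<close>
  have w_rpow: "w x * rpow (\<mu> x) r = (x - a) powr p * (b - x) powr (q + r) * (1 / (b - a) powr r)"
    if "x \<in> {a..b}" for x
    using that assms by (simp add: w_def rpow_def \<mu>_def powr_divide powr_add)
  have "((\<lambda>x. (x - a) powr p * (b - x) powr (q + r) * (1 / (b - a) powr r))
      has_integral (b - a) powr (p + (q + r) + 1) * Beta (q + r + 1) (p + 1)
        * (1 / (b - a) powr r)) {a..b}"
    using has_integral_Beta_weight[of a b p "q + r"] assms r
    by (intro has_integral_mult_left) simp
  also have "(b - a) powr (p + (q + r) + 1) * Beta (q + r + 1) (p + 1) * (1 / (b - a) powr r)
      = D * Beta (q + r + 1) (p + 1)"
    using assms by (simp add: D_def powr_add)
  finally have w_rpow_int: "((\<lambda>x. w x * rpow (\<mu> x) r)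
      has_integral D * Beta (q + r + 1) (p + 1)) {a..b}"
    by (rule has_integral_eq[rotated]) (simp only: w_rpow)

  have "((\<lambda>x. (A - m * C) * (w x * rpow (\<mu> x) r) + m * C * w x) has_integral
      (A - m * C) * (D * Beta (q + r + 1) (p + 1)) + m * C * (D * B)) {a..b}"
    by (intro has_integral_add has_integral_mult_right w_int w_rpow_int)
  then have wg_int: "((\<lambda>x. w x * g x) has_integral D * K) {a..b}"
    by (simp add: g_def K_def algebra_simps)

  have maj: "\<bar>f x\<bar> powr l \<le> g x" if x: "x \<in> {a..b}" for x
  proof -
    have \<mu>: "\<mu> x \<in> {0..1}"
      using x assms by (simp add: \<mu>_def divide_simps)
    have "\<mu> x * (b - a) = b - x" using assms by (simp add: \<mu>_def)
    then have "\<mu> x * a + (1 - \<mu> x) * b = x" by (simp add: algebra_simps)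
    moreover have "\<bar>f (\<mu> x * a + (1 - \<mu> x) * b)\<bar> powr l \<le> g x"
      using assms(11) \<mu> \<open>a < b\<close> unfolding class_K1_def g_def A_def C_def r_def
      by fastforce
    ultimately show ?thesis by simp
  qed
  have w_nonneg: "0 \<le> w x" for x by (simp add: w_def)

  have "continuous_on {a..b} (\<lambda>x. w x * f x)"
    unfolding w_def using assms by (intro continuous_intros continuous_on_powr') auto
  then have abs_int: "(\<lambda>x. w x * f x) absolutely_integrable_on {a..b}"
    by (rule absolutely_integrable_continuous_real)
  have "((\<lambda>x. w x * f x) has_integral (LINT x:{a..b}|lebesgue. w x * f x)) {a..b}"
    by (rule has_integral_set_lebesgue[OF abs_int])
  from weighted_Hoelder_majorant[OF \<open>l \<ge> 1\<close> _ w_int wg_int this w_nonneg maj] D B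
  have "(LINT x:{a..b}|lebesgue. w x * f x) \<le> (D * B) powr ((l - 1) / l) * (D * K) powr (1 / l)"
    by simp
  also have "\<dots> = D powr ((l - 1) / l + 1 / l) * B powr ((l - 1) / l) * K powr (1 / l)"
    by (simp add: powr_mult powr_add)
  also have "(l - 1) / l + 1 / l = 1"
    using \<open>l \<ge> 1\<close> by (simp add: field_simps)
  finally show ?thesis
    using D by (simp add: w_def D_def B_def K_def A_def C_def r_def)
qed

end
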